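(* Let $G$ be a non-abelian simple group generated by a finite set $X \subset G$. Then there exists a generating set $\tilde{X}$ of $G$, obtained from $X$ by adding at most one element of $G$ (that is, $\tilde X = X$ or $\tilde X = X\cup\{c\}$ for some $c\in G$), such that $pw(G,\tilde{X})=1$.
   Context: Let $G$ be a group with generating set $X$, and write $X^{\pm 1} = X \cup X^{-1}$. Let $F_X$ be the free group on $X$ and $\pi: F_X \to G$ the natural map. An element of $F_X$ is called a palindrome if it can be written as $y_1 y_2 \cdots y_k$ with each $y_j \in X^{\pm 1}$ (regarded as letters of $F_X$) and $y_j = y_{k-j+1}$ for all $1 \le j \le k$. An element of $G$ is called a palindrome (with respect to $X$) if at least one of its preimages under $\pi$ is a palindrome in $F_X$. Let $P_{G,X}$ be the set of all palindromes of $G$ with respect to $X$. The palindromic width of $G$ with respect to $X$ is $$pw(G,X)=\sup_{g \in G} \min\Big\{ k \;\Big|\; g = \prod_{i=1}^k p_i,\ p_i \in P_{G,X}\Big\},$$ which may be infinite. *)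

theory Defs
  imports "HOL-Algebra.Generated_Groups" "HOL-Library.Extended_Nat"
begin

section \<open>Simple groups\<close>

text \<open>The locale \<open>simple_group\<close> of HOL-Algebra demands \<open>order G > 1\<close>. As \<open>order\<close> is a
  natural-number cardinality, which is \<open>0\<close> for infinite carriers, it describes only finite
  simple groups. The following version also covers the infinite ones.\<close>

locale abstract_simple_group = group +
  assumes nontrivial: "carrier G \<noteq> {\<one>}"
    and normal_trivial: "\<And>H. H \<lhd> G \<Longrightarrow> H = carrier G \<or> H = {\<one>}"

section \<open>The free group on a set\<close>

text \<open>The letter \<open>(x, True)\<close> stands for the generator \<open>x\<close>, and \<open>(x, False)\<close> for its formal
  inverse. Elements of the free group are the reduced words.\<close>

type_synonym 'a letter = "'a \<times> bool"

definition inv_letter :: "'a letter \<Rightarrow> 'a letter" where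
  "inv_letter l = (fst l, \<not> snd l)"

fun reduced :: "'a letter list \<Rightarrow> bool" where
  "reduced [] = True"
| "reduced [l] = True"
| "reduced (l # m # w) = (m \<noteq> inv_letter l \<and> reduced (m # w))"

fun cons_reduce :: "'a letter \<Rightarrow> 'a letter list \<Rightarrow> 'a letter list" where
  "cons_reduce l [] = [l]"
| "cons_reduce l (m # w) = (if m = inv_letter l then w else l # m # w)"

definition reduce :: "'a letter list \<Rightarrow> 'a letter list" where
  "reduce w = foldr cons_reduce w []"

definition free_group :: "'a set \<Rightarrow> 'a letter list monoid" where
  "free_group X =
    \<lparr>carrier = {w \<in> lists (X \<times> UNIV). reduced w}, mult = (\<lambda>u v. reduce (u @ v)), one = []\<rparr>"

text \<open>The letters \<open>X\<^sup>\<plusminus>\<^sup>1\<close>, as elements of the free group. If \<open>x\<close> and \<open>inv x\<close> both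
  lie in \<open>X\<close>, then the formal inverse of \<open>x\<close> and the generator \<open>inv x\<close> are different
  letters.\<close>

definition free_letters :: "'a set \<Rightarrow> 'a letter list set" where
  "free_letters X = (\<lambda>l. [l]) ` (X \<times> UNIV)"

definition natural_map :: "('a, 'b) monoid_scheme \<Rightarrow> 'a letter list \<Rightarrow> 'a" where
  "natural_map G w =
    foldr (\<lambda>(x, b) g. (if b then x else inv\<^bsub>G\<^esub> x) \<otimes>\<^bsub>G\<^esub> g) w \<one>\<^bsub>G\<^esub>"

section \<open>Palindromes and palindromic width\<close>

text \<open>The palindromic expression \<open>ys\<close> need not be a reduced word.\<close>

definition free_palindromes :: "'a set \<Rightarrow> 'a letter list set" where
  "free_palindromes X =
    {foldr (\<otimes>\<^bsub>free_group X\<^esub>) ys \<one>\<^bsub>free_group X\<^esub> |ys. set ys \<subseteq> free_letters X \<and> rev ys = ys}"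

definition palindromes :: "('a, 'b) monoid_scheme \<Rightarrow> 'a set \<Rightarrow> 'a set" where
  "palindromes G X =
    {g \<in> carrier G. \<exists>w \<in> carrier (free_group X). natural_map G w = g \<and> w \<in> free_palindromes X}"

text \<open>The infimum of the empty set is \<open>\<infinity>\<close>; the empty product (\<open>k = 0\<close>) is allowed.\<close>

definition palindromic_length :: "('a, 'b) monoid_scheme \<Rightarrow> 'a set \<Rightarrow> 'a \<Rightarrow> enat" where
  "palindromic_length G X g =
    Inf {enat (length ps) |ps. set ps \<subseteq> palindromes G X \<and> g = foldr (\<otimes>\<^bsub>G\<^esub>) ps \<one>\<^bsub>G\<^esub>}"

definition palindromic_width :: "('a, 'b) monoid_scheme \<Rightarrow> 'a set \<Rightarrow> enat" where
  "palindromic_width G X = (SUP g \<in> carrier G. palindromic_length G X g)"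

section \<open>The free group is a group, and the natural map a homomorphism\<close>

lemma inv_letter_inv_letter [simp]: "inv_letter (inv_letter l) = l"
  by (simp add: inv_letter_def)

lemma inv_letter_simps [simp]: "inv_letter (x, b) = (x, \<not> b)"
  by (simp add: inv_letter_def)

lemma inv_letter_in_iff [simp]: "inv_letter l \<in> X \<times> UNIV \<longleftrightarrow> l \<in> X \<times> UNIV"
  by (cases l) simp

lemma reduced_ConsD: "reduced (l # w) \<Longrightarrow> reduced w"
  by (cases w) auto

lemma reduced_cons_reduce: "reduced w \<Longrightarrow> reduced (cons_reduce l w)"
  by (cases w) (auto dest: reduced_ConsD)

lemma cons_reduce_cancel:
  assumes "reduced w"
  shows "cons_reduce l (cons_reduce (inv_letter l) w) = w"
proof (cases w)
  case (Cons m v)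
  then show ?thesis using assms by (cases v) auto
qed simp

lemma cons_reduce_reduced: "reduced (l # w) \<Longrightarrow> cons_reduce l w = l # w"
  by (cases w) auto

lemma reduced_foldr_cons_reduce: "reduced v \<Longrightarrow> reduced (foldr cons_reduce u v)"
  by (induction u) (auto intro: reduced_cons_reduce)

lemma reduced_reduce: "reduced (reduce w)"
  by (simp add: reduce_def reduced_foldr_cons_reduce)

lemma reduce_reduced: "reduced w \<Longrightarrow> reduce w = w"
proof (induction w)
  case (Cons l w)
  then have "reduce w = w" by (blast dest: reduced_ConsD)
  with cons_reduce_reduced[OF Cons.prems] show ?case by (simp add: reduce_def)
qed (simp add: reduce_def)

lemma foldr_cons_reduce_cons_reduce:
  assumes "reduced v"
  shows "foldr cons_reduce (cons_reduce l u) v = cons_reduce l (foldr cons_reduce u v)"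
proof (cases u)
  case (Cons m w)
  show ?thesis
  proof (cases "m = inv_letter l")
    case True
    then show ?thesis
      using Cons cons_reduce_cancel[OF reduced_foldr_cons_reduce[OF assms]] by simp
  qed (simp add: Cons)
qed simp

lemma foldr_cons_reduce_reduce:
  "reduced v \<Longrightarrow> foldr cons_reduce (reduce u) v = foldr cons_reduce u v"
  by (induction u) (simp_all add: reduce_def foldr_cons_reduce_cons_reduce)

lemma reduce_append: "reduce (u @ v) = foldr cons_reduce u (reduce v)"
  by (simp add: reduce_def)

lemma reduce_append_reduce_left: "reduce (reduce u @ v) = reduce (u @ v)"
  by (simp add: reduce_append foldr_cons_reduce_reduce reduced_reduce)

lemma reduce_append_reduce_right: "reduce (u @ reduce v) = reduce (u @ v)"
  by (simp add: reduce_append reduce_reduced reduced_reduce)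

lemma cons_reduce_in_lists: "l \<in> A \<Longrightarrow> w \<in> lists A \<Longrightarrow> cons_reduce l w \<in> lists A"
  by (cases w) auto

lemma reduce_in_lists: "w \<in> lists A \<Longrightarrow> reduce w \<in> lists A"
proof (induction w)
  case (Cons l w)
  have "reduce (l # w) = cons_reduce l (reduce w)" by (simp add: reduce_def)
  moreover have "l \<in> A" "reduce w \<in> lists A" using Cons by auto
  ultimately show ?case by (simp only: cons_reduce_in_lists)
qed (simp add: reduce_def)

lemma reduce_inverse: "reduce (rev (map inv_letter w) @ w) = []"
proof (induction w)
  case (Cons l w)
  have "cons_reduce (inv_letter l) (cons_reduce l (reduce w)) = reduce w"
    using cons_reduce_cancel[of "reduce w" "inv_letter l"] by (simp add: reduced_reduce)
  with Cons show ?case by (simp add: reduce_append) (simp add: reduce_def)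
qed (simp add: reduce_def)

lemma group_free_group: "group (free_group X)"
proof (rule groupI)
  fix w assume w: "w \<in> carrier (free_group X)"
  let ?v = "reduce (rev (map inv_letter w))"
  have "rev (map inv_letter w) \<in> lists (X \<times> UNIV)"
    using w by (auto simp: free_group_def in_lists_conv_set inv_letter_def)
  then have "?v \<in> carrier (free_group X)"
    using reduce_in_lists by (auto simp: free_group_def reduced_reduce)
  moreover have "?v \<otimes>\<^bsub>free_group X\<^esub> w = \<one>\<^bsub>free_group X\<^esub>"
    by (simp add: free_group_def reduce_append_reduce_left reduce_inverse)
  ultimately show "\<exists>v \<in> carrier (free_group X). v \<otimes>\<^bsub>free_group X\<^esub> w = \<one>\<^bsub>free_group X\<^esub>"
    by blast
next
  fix u v assume "u \<in> carrier (free_group X)" "v \<in> carrier (free_group X)"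
  then have "u @ v \<in> lists (X \<times> UNIV)" by (simp add: free_group_def)
  then show "u \<otimes>\<^bsub>free_group X\<^esub> v \<in> carrier (free_group X)"
    using reduce_in_lists[of "u @ v" "X \<times> UNIV"] by (simp add: free_group_def reduced_reduce)
qed (simp_all add: free_group_def reduce_append_reduce_left reduce_append_reduce_right
       reduce_reduced)

context group
begin

lemma natural_map_Nil [simp]: "natural_map G [] = \<one>"
  by (simp add: natural_map_def)

lemma natural_map_Cons [simp]:
  "natural_map G ((x, b) # w) = (if b then x else inv x) \<otimes> natural_map G w"
  by (simp add: natural_map_def)

lemma natural_map_closed:
  "X \<subseteq> carrier G \<Longrightarrow> w \<in> lists (X \<times> UNIV) \<Longrightarrow> natural_map G w \<in> carrier G"
  by (induction w) auto

lemma natural_map_append: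
  assumes "X \<subseteq> carrier G" "u \<in> lists (X \<times> UNIV)" "v \<in> lists (X \<times> UNIV)"
  shows "natural_map G (u @ v) = natural_map G u \<otimes> natural_map G v"
  using assms(2)
proof (induction u)
  case Nil
  then show ?case using natural_map_closed[OF assms(1,3)] by simp
next
  case (Cons l u)
  then obtain x b where l: "l = (x, b)" and x: "x \<in> carrier G" and u: "u \<in> lists (X \<times> UNIV)"
    using assms(1) by (cases l) auto
  show ?case
    using Cons.IH l x natural_map_closed[OF assms(1,3)] natural_map_closed[OF assms(1) u]
    by (simp add: m_assoc)
qed

lemma natural_map_cons_reduce:
  assumes "X \<subseteq> carrier G" "l \<in> X \<times> UNIV" "w \<in> lists (X \<times> UNIV)"
  shows "natural_map G (cons_reduce l w) = natural_map G (l # w)"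
proof (cases w)
  case (Cons m v)
  obtain x b where l: "l = (x, b)" by (cases l)
  have x: "x \<in> carrier G" using assms l by auto
  have v: "natural_map G v \<in> carrier G"
    using natural_map_closed[OF assms(1), of v] assms(3) Cons by simp
  show ?thesis using x v by (auto simp: Cons l m_assoc[symmetric])
qed simp

lemma natural_map_reduce:
  assumes "X \<subseteq> carrier G" "w \<in> lists (X \<times> UNIV)"
  shows "natural_map G (reduce w) = natural_map G w"
  using assms(2)
proof (induction w)
  case (Cons l w)
  then have l: "l \<in> X \<times> UNIV" and w: "w \<in> lists (X \<times> UNIV)" by auto
  have "natural_map G (reduce (l # w)) = natural_map G (l # reduce w)"
    using natural_map_cons_reduce[OF assms(1) l reduce_in_lists[OF w]] by (simp add: reduce_def)
  also have "\<dots> = natural_map G (l # w)"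
    using Cons.IH by (cases l) simp
  finally show ?case .
qed (simp add: reduce_def)

lemma natural_map_hom:
  assumes "X \<subseteq> carrier G"
  shows "natural_map G \<in> hom (free_group X) G"
proof (rule homI)
  fix w assume "w \<in> carrier (free_group X)"
  then show "natural_map G w \<in> carrier G"
    using natural_map_closed[OF assms] by (simp add: free_group_def)
next
  fix u v assume "u \<in> carrier (free_group X)" "v \<in> carrier (free_group X)"
  then have uv: "u \<in> lists (X \<times> UNIV)" "v \<in> lists (X \<times> UNIV)" by (auto simp: free_group_def)
  then have "natural_map G (reduce (u @ v)) = natural_map G (u @ v)"
    by (intro natural_map_reduce[OF assms]) simp
  with natural_map_append[OF assms uv]
  show "natural_map G (u \<otimes>\<^bsub>free_group X\<^esub> v) = natural_map G u \<otimes> natural_map G v"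
    by (simp add: free_group_def)
qed

lemma natural_map_generator: "x \<in> carrier G \<Longrightarrow> natural_map G [(x, True)] = x"
  by simp

end

end

theory Submission
  imports Defs
begin

text \<open>Let \<open>N\<close> be the kernel of \<open>\<pi> : F\<^sub>X \<rightarrow> G\<close>. Reversal of words is an anti-automorphism of
  \<open>F\<^sub>X\<close>, so the reversals of the elements of \<open>N\<close> have a normal subgroup of \<open>G\<close> as their
  image. If this image is \<open>G\<close>, then every \<open>g\<close> is \<open>\<pi> (rev v)\<close> with \<open>\<pi> v = 1\<close>, hence the image
  of the palindrome \<open>v @ rev v\<close>. Otherwise reversal preserves the relations of \<open>G\<close>. If it did so
  for \<open>X \<union> {c}\<close> with every \<open>c = \<pi> u\<close>, then the relation \<open>u = c\<close> would give \<open>\<pi> (rev u) = \<pi> u\<close>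
  for every word \<open>u\<close>, so the identity would be an anti-automorphism of \<open>G\<close>, and \<open>G\<close> would be
  abelian.\<close>

text \<open>The inverse in the free group, taken before any reduction. On raw words, inversion and
  reversal commute as list operations.\<close>

definition inv_word :: "'a letter list \<Rightarrow> 'a letter list" where
  "inv_word w = rev (map inv_letter w)"

lemma inv_word_in_lists_iff [simp]: "inv_word w \<in> lists (X \<times> UNIV) \<longleftrightarrow> w \<in> lists (X \<times> UNIV)"
  by (induction w) (auto simp: inv_word_def)

lemma rev_in_lists_iff [simp]: "rev w \<in> lists A \<longleftrightarrow> w \<in> lists A"
  by (simp add: in_lists_conv_set)

lemma inv_word_Cons: "inv_word (l # w) = inv_word w @ [inv_letter l]"
  by (simp add: inv_word_def)

lemma rev_inv_word: "rev (inv_word w) = inv_word (rev w)"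
  by (simp add: inv_word_def rev_map)

lemma foldr_mult_free_group:
  "foldr (\<otimes>\<^bsub>free_group X\<^esub>) (map (\<lambda>l. [l]) w) \<one>\<^bsub>free_group X\<^esub> = reduce w"
proof (induction w)
  case (Cons l w)
  have "reduce (l # reduce w) = reduce (l # w)"
    using reduce_append_reduce_right[of "[l]" w] by simp
  with Cons show ?case by (simp add: free_group_def)
qed (simp add: free_group_def reduce_def)

text \<open>The palindromic expression is the list of one-letter words of \<open>w\<close>, whose
  product in the free group is \<open>reduce w\<close>. Thus \<open>w\<close> itself may contain
  cancelling pairs.\<close>

lemma reduce_in_free_palindromes:
  assumes "w \<in> lists (X \<times> UNIV)" "rev w = w"
  shows "reduce w \<in> free_palindromes X"
proof -
  have "set (map (\<lambda>l. [l]) w) \<subseteq> free_letters X"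
    using assms(1) by (auto simp: free_letters_def in_lists_conv_set)
  moreover have "rev (map (\<lambda>l. [l]) w) = map (\<lambda>l. [l]) w"
    using assms(2) by (simp add: rev_map)
  ultimately show ?thesis
    unfolding free_palindromes_def
    by (intro CollectI exI conjI) (rule foldr_mult_free_group[symmetric])
qed

context group
begin

lemma natural_map_inv_word:
  assumes X: "X \<subseteq> carrier G" and w: "w \<in> lists (X \<times> UNIV)"
  shows "natural_map G (inv_word w) = inv (natural_map G w)"
  using w
proof (induction w)
  case (Cons l w)
  obtain x b where l: "l = (x, b)" and x: "x \<in> X" "x \<in> carrier G"
    using Cons X by (cases l) auto
  have "natural_map G (inv_word (l # w))
      = natural_map G (inv_word w) \<otimes> natural_map G [inv_letter l]"
    using natural_map_append[OF X, of "inv_word w" "[inv_letter l]"] Cons x l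
    by (simp add: inv_word_Cons)
  then show ?case
    using Cons x l natural_map_closed[OF X, of w] by (auto simp: inv_mult_group)
qed (simp add: inv_word_def)

lemma natural_map_surj:
  assumes X: "X \<subseteq> carrier G" and g: "g \<in> generate G X"
  shows "\<exists>w \<in> lists (X \<times> UNIV). natural_map G w = g"
  using g
proof (induction g)
  case one
  then show ?case by (intro bexI[of _ "[]"]) auto
next
  case (incl h)
  then show ?case using X by (intro bexI[of _ "[(h, True)]"]) auto
next
  case (inv h)
  then show ?case using X by (intro bexI[of _ "[(h, False)]"]) auto
next
  case (eng g h)
  then obtain u v where "u \<in> lists (X \<times> UNIV)" "natural_map G u = g"
    "v \<in> lists (X \<times> UNIV)" "natural_map G v = h" by blast
  then show ?case using natural_map_append[OF X] by (intro bexI[of _ "u @ v"]) auto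
qed

text \<open>Reduction does not change the value in \<open>G\<close>, so \<open>reduce w\<close> is
  the required preimage. From here on, palindromes are handled as unreduced words.\<close>

lemma natural_map_in_palindromes:
  assumes X: "X \<subseteq> carrier G" and w: "w \<in> lists (X \<times> UNIV)" "rev w = w"
  shows "natural_map G w \<in> palindromes G X"
proof -
  have "reduce w \<in> carrier (free_group X)"
    using reduce_in_lists[OF w(1)] by (simp add: free_group_def reduced_reduce)
  then show ?thesis
    unfolding palindromes_def
    using natural_map_closed[OF X w(1)] natural_map_reduce[OF X w(1)]
      reduce_in_free_palindromes[OF w] by blast
qed

text \<open>Image in \<open>G\<close> of the reversed kernel of \<open>natural_map G\<close>. Since
  words may be unreduced, concatenations of witnesses are again witnesses.\<close>

definition reversed_relators :: "'a set \<Rightarrow> 'a set" where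
  "reversed_relators X =
    {natural_map G (rev w) |w. w \<in> lists (X \<times> UNIV) \<and> natural_map G w = \<one>}"

lemma reversed_relatorsI:
  "w \<in> lists (X \<times> UNIV) \<Longrightarrow> natural_map G w = \<one> \<Longrightarrow> natural_map G (rev w) = g
    \<Longrightarrow> g \<in> reversed_relators X"
  unfolding reversed_relators_def by blast

lemma reversed_relatorsE:
  assumes "g \<in> reversed_relators X"
  obtains w where "w \<in> lists (X \<times> UNIV)" "natural_map G w = \<one>" "g = natural_map G (rev w)"
  using assms unfolding reversed_relators_def by blast

lemma reversed_relators_normal:
  assumes X: "X \<subseteq> carrier G" and gen: "generate G X = carrier G"
  shows "reversed_relators X \<lhd> G" (is "?K \<lhd> G")
proof -
  note closed = natural_map_closed[OF X]
  note app = natural_map_append[OF X]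
  note invw = natural_map_inv_word[OF X]
  have "subgroup ?K G"
  proof (rule subgroupI)
    show "?K \<subseteq> carrier G"
      by (auto elim!: reversed_relatorsE intro!: closed)
    have "\<one> \<in> ?K" by (rule reversed_relatorsI[of "[]"]) simp_all
    then show "?K \<noteq> {}" by blast
  next
    fix a assume "a \<in> ?K"
    then obtain w where w: "w \<in> lists (X \<times> UNIV)" "natural_map G w = \<one>"
      and a: "a = natural_map G (rev w)" by (rule reversed_relatorsE)
    have "natural_map G (rev (inv_word w)) = inv a"
      using w by (simp add: a rev_inv_word invw)
    moreover have "natural_map G (inv_word w) = \<one>" using w by (simp add: invw)
    moreover have "inv_word w \<in> lists (X \<times> UNIV)" using w(1) by simp
    ultimately show "inv a \<in> ?K" by (intro reversed_relatorsI)
  next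
    fix a b assume "a \<in> ?K" "b \<in> ?K"
    from \<open>a \<in> ?K\<close> obtain v where v: "v \<in> lists (X \<times> UNIV)" "natural_map G v = \<one>"
      and a: "a = natural_map G (rev v)" by (elim reversed_relatorsE)
    from \<open>b \<in> ?K\<close> obtain w where w: "w \<in> lists (X \<times> UNIV)" "natural_map G w = \<one>"
      and b: "b = natural_map G (rev w)" by (rule reversed_relatorsE)
    \<comment> \<open>Reversal swaps the factors, so the witness for \<open>a \<otimes> b\<close> is
      \<open>w @ v\<close>.\<close>
    have "natural_map G (rev (w @ v)) = a \<otimes> b"
      using v w app[of "rev v" "rev w"] by (simp add: a b)
    moreover have "natural_map G (w @ v) = \<one>"
      using v w app[of w v] by simp
    moreover have "w @ v \<in> lists (X \<times> UNIV)" using v w by simp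
    ultimately show "a \<otimes> b \<in> ?K" by (intro reversed_relatorsI)
  qed
  moreover have "x \<otimes> h \<otimes> inv x \<in> ?K" if x: "x \<in> carrier G" and h: "h \<in> ?K" for x h
  proof -
    obtain a' where a': "a' \<in> lists (X \<times> UNIV)" "natural_map G a' = x"
      using natural_map_surj[OF X] x gen by blast
    \<comment> \<open>The conjugating word must have value \<open>x\<close> after reversal, because
      reversing \<open>inv_word a @ w @ a\<close> puts \<open>rev a\<close> in front. The value of
      \<open>a\<close> itself cancels around the relator \<open>w\<close>.\<close>
    define a where "a = rev a'"
    have a: "a \<in> lists (X \<times> UNIV)" "natural_map G (rev a) = x"
      using a' unfolding a_def by simp_all
    obtain w where w: "w \<in> lists (X \<times> UNIV)" "natural_map G w = \<one>"
      and h: "h = natural_map G (rev w)" using h by (rule reversed_relatorsE)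
    let ?u = "inv_word a @ w @ a"
    have u: "?u \<in> lists (X \<times> UNIV)" using a(1) w(1) by simp
    have "rev ?u = (rev a @ rev w) @ inv_word (rev a)" by (simp add: rev_inv_word)
    then have "natural_map G (rev ?u) = x \<otimes> h \<otimes> inv x"
      using a w app[of "rev a @ rev w" "inv_word (rev a)"] app[of "rev a" "rev w"]
        invw[of "rev a"] h by simp
    moreover have "natural_map G ?u = \<one>"
      using a(1) w app[of "inv_word a" "w @ a"] app[of w a] invw[of a] closed[of a] by simp
    ultimately show ?thesis using u by (intro reversed_relatorsI)
  qed
  ultimately show ?thesis by (simp add: normal_inv_iff)
qed

lemma palindromic_width_eq_1:
  assumes pal: "carrier G \<subseteq> palindromes G X" and nontriv: "carrier G \<noteq> {\<one>}"
  shows "palindromic_width G X = 1"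
proof (rule antisym)
  have "palindromic_length G X g \<le> enat (length [g])" if "g \<in> carrier G" for g
    unfolding palindromic_length_def
    by (rule Inf_lower, intro CollectI exI[of _ "[g]"]) (use that pal in auto)
  then show "palindromic_width G X \<le> 1"
    unfolding palindromic_width_def by (intro SUP_least) (simp add: one_enat_def)
next
  \<comment> \<open>The empty product has length 0 but represents only \<open>\<one>\<close>; any
    other element forces width at least 1.\<close>
  obtain g where g: "g \<in> carrier G" "g \<noteq> \<one>" using nontriv by blast
  have "1 \<le> palindromic_length G X g"
    unfolding palindromic_length_def
  proof (rule Inf_greatest)
    fix n assume "n \<in> {enat (length ps) |ps.
      set ps \<subseteq> palindromes G X \<and> g = foldr (\<otimes>) ps \<one>}"
    then obtain ps where "n = enat (length ps)" "g = foldr (\<otimes>) ps \<one>" by blast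
    with g(2) show "1 \<le> n" by (cases ps) (auto simp: one_enat_def)
  qed
  with g(1) show "1 \<le> palindromic_width G X"
    unfolding palindromic_width_def by (rule SUP_upper2)
qed

end

context abstract_simple_group
begin

text \<open>By simplicity the normal subgroup \<open>reversed_relators X\<close> is everything or
  trivial; these cases give the two disjuncts.\<close>

lemma palindromic_width_eq_1_or_rev_relation:
  assumes X: "X \<subseteq> carrier G" and gen: "generate G X = carrier G"
  shows "palindromic_width G X = 1
    \<or> (\<forall>w \<in> lists (X \<times> UNIV). natural_map G w = \<one> \<longrightarrow> natural_map G (rev w) = \<one>)"
proof -
  consider "reversed_relators X = carrier G" | "reversed_relators X = {\<one>}"
    using normal_trivial[OF reversed_relators_normal[OF X gen]] by blast
  then show ?thesis
  proof cases
    case 1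
    have "g \<in> palindromes G X" if "g \<in> carrier G" for g
    proof -
      have "g \<in> reversed_relators X" using that 1 by simp
      then obtain v where v: "v \<in> lists (X \<times> UNIV)" "natural_map G v = \<one>"
        and g: "g = natural_map G (rev v)" by (rule reversed_relatorsE)
      have "natural_map G (v @ rev v) = g"
        using v g that natural_map_append[OF X, of v "rev v"] by simp
      then show ?thesis
        using natural_map_in_palindromes[OF X, of "v @ rev v"] v(1) by simp
    qed
    then show ?thesis using palindromic_width_eq_1 nontrivial by blast
  next
    case 2
    then show ?thesis using reversed_relatorsI by blast
  qed
qed

end

text \<open>If \<open>u\<close> and \<open>v\<close> represent \<open>x\<close> and
  \<open>y\<close>, then \<open>u @ v\<close> has value \<open>x \<otimes> y\<close> while its
  reversal has value \<open>y \<otimes> x\<close>.\<close>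

lemma (in group) comm_group_if_rev_invariant:
  assumes X: "X \<subseteq> carrier G" and gen: "generate G X = carrier G"
    and rev: "\<And>w. w \<in> lists (X \<times> UNIV) \<Longrightarrow> natural_map G (rev w) = natural_map G w"
  shows "comm_group G"
proof (rule group_comm_groupI)
  fix x y assume "x \<in> carrier G" "y \<in> carrier G"
  then have "x \<in> generate G X" "y \<in> generate G X" using gen by simp_all
  then obtain u v where u: "u \<in> lists (X \<times> UNIV)" "natural_map G u = x"
    and v: "v \<in> lists (X \<times> UNIV)" "natural_map G v = y"
    by (elim natural_map_surj[OF X, THEN bexE])
  have "x \<otimes> y = natural_map G (rev (u @ v))"
    using u v rev[of "u @ v"] natural_map_append[OF X, of u v] by simp
  also have "\<dots> = y \<otimes> x"
    using u v rev[of u] rev[of v] natural_map_append[OF X, of "rev v" "rev u"] by simp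
  finally show "x \<otimes> y = y \<otimes> x" .
qed

theorem theorem4:
  fixes G :: "('a, 'b) monoid_scheme" and X :: "'a set"
  assumes "abstract_simple_group G"
    and "\<not> comm_group G"
    and "X \<subseteq> carrier G"
    and "finite X"
    and "generate G X = carrier G"
  shows "\<exists>X'. (X' = X \<or> (\<exists>c \<in> carrier G. X' = X \<union> {c}))
           \<and> generate G X' = carrier G
           \<and> palindromic_width G X' = 1"
proof -
  interpret abstract_simple_group G by fact
  note X = assms(3) and gen = assms(5)
  obtain u where u: "u \<in> lists (X \<times> UNIV)" and ne: "natural_map G (rev u) \<noteq> natural_map G u"
    using comm_group_if_rev_invariant[OF X gen] assms(2) by blast
  define c where "c = natural_map G u"
  let ?X = "X \<union> {c}"
  have c: "c \<in> carrier G" using natural_map_closed[OF X u] by (simp add: c_def)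
  have X': "?X \<subseteq> carrier G" using X c by simp
  have gen': "generate G ?X = carrier G"
    using mono_generate[of X ?X] generate_incl[OF X'] gen by blast
  have u': "u \<in> lists (?X \<times> UNIV)" using u by auto
  \<comment> \<open>The relation \<open>u = c\<close> written as a relator. Its reversal has value
    \<open>inv c\<close> times the value of \<open>rev u\<close>, which is not \<open>\<one>\<close>
    by the choice of \<open>u\<close>. This rules out the second alternative of the dichotomy for
    \<open>?X\<close>.\<close>
  let ?w = "u @ [(c, False)]"
  have w: "?w \<in> lists (?X \<times> UNIV)" using u' by simp
  have rc: "natural_map G (rev u) \<in> carrier G" using natural_map_closed[OF X, of "rev u"] u by simp
  have "natural_map G ?w = \<one>\<^bsub>G\<^esub>"
    using natural_map_append[OF X' u', of "[(c, False)]"] c by (simp add: c_def[symmetric])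
  moreover have "natural_map G (rev ?w) \<noteq> \<one>\<^bsub>G\<^esub>"
  proof
    assume "natural_map G (rev ?w) = \<one>\<^bsub>G\<^esub>"
    then have "inv\<^bsub>G\<^esub> c \<otimes>\<^bsub>G\<^esub> natural_map G (rev u) = \<one>\<^bsub>G\<^esub>" by simp
    then have "natural_map G (rev u) = c" using inv_equality[of "inv\<^bsub>G\<^esub> c"] c rc
      by (metis inv_closed inv_comm inv_equality inv_inv)
    with ne show False by (simp add: c_def)
  qed
  ultimately have "palindromic_width G ?X = 1"
    using palindromic_width_eq_1_or_rev_relation[OF X' gen'] w by blast
  with c gen' show ?thesis by blast
qed

end
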